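(* The sequence of iterates $\{\mathbf{z}^r\}_{r\ge 0}$ generated by the cyclic coordinatewise descent algorithm for minimizing $f_2$ converges to some $\mathbf{z}^*\in\mathcal{X}$ such that $f_2(\mathbf{z}^* )\le f_2(\mathbf{x})$ for every $\mathbf{x}\in\mathcal{X}$.
   Context: Setting. Let $m,n\ge 1$ be integers, $S\subseteq\{1,\dots,n\}$ with complement $S^c=\{1,\dots,n\}\setminus S$, $\lambda>0$, and $E$ a real $m\times n$ matrix with no zero column. Put $\mathcal{X}=\{\mathbf{x}\in\mathbb{R}^n: x_i\ge 0 \text{ for every } i\in S^c\}$ and, for $\mathbf{x}\in\mathcal{X}$, $f_2(\mathbf{x})=\mathbf{x}^TE^TE\mathbf{x}-\sum_{i\in S^c}\log x_i+\lambda\sum_{i\in S}|x_i|$, with the convention $-\log 0=+\infty$. Assumption (A5)*. For every $\xi\in\mathbb{R}$ there exists $\xi^*>0$ such that every $\mathbf{x}\in\mathcal{X}$ with $f_2(\mathbf{x})\le\xi$ satisfies $1/\xi^*\le x_i\le\xi^*$ for every $i\in S^c$ and $|x_i|\le\xi^*$ for every $i\in S$. Cyclic coordinatewise descent algorithm for $f_2$. Start with $\mathbf{z}^0\in\mathcal{X}$ such that $f_2(\mathbf{z}^0)$ is finite. For $r=0,1,2,\dots$: set $\mathbf{z}^{r,0}=\mathbf{z}^r$; for $i=1,2,\dots,n$ let $\mathbf{z}^{r,i}$ be the (unique) minimizer of $f_2(\mathbf{x})$ over all $\mathbf{x}\in\mathcal{X}$ with $x_j=z^{r,i-1}_j$ for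 all $j\neq i$; set $\mathbf{z}^{r+1}=\mathbf{z}^{r,n}$. The algorithm is run indefinitely, giving an infinite sequence $\{\mathbf{z}^r\}_{r\ge0}$. *)

theory Defs
  imports "HOL-Analysis.Analysis"
begin

text \<open>
  The coordinates \<open>1, \<dots>, n\<close> are the elements of a finite type \<open>'n\<close>, so that \<open>S\<^sup>c\<close> is \<open>- S\<close>;
  the order in which they are visited is given separately, by a bijection \<open>e\<close> from
  \<open>{1..CARD('n)}\<close> onto \<open>'n\<close>.
\<close>

definition feasible :: "'n::finite set \<Rightarrow> (real ^ 'n) set" where
  "feasible S = {x. \<forall>i\<in>- S. 0 \<le> x $ i}"

text \<open>Only arguments \<open>t \<ge> 0\<close> matter below; the value at \<open>0\<close> is the convention \<open>- log 0 = + \<infinity>\<close>.\<close>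

definition neg_log :: "real \<Rightarrow> ereal" where
  "neg_log t = (if 0 < t then ereal (- ln t) else \<infinity>)"

definition f2 :: "'n::finite set \<Rightarrow> real \<Rightarrow> real ^ 'n ^ 'm::finite \<Rightarrow> real ^ 'n \<Rightarrow> ereal" where
  "f2 S lam E x =
     ereal (x \<bullet> ((transpose E ** E) *v x)) + (\<Sum>i\<in>- S. neg_log (x $ i))
     + ereal (lam * (\<Sum>i\<in>S. \<bar>x $ i\<bar>))"

definition assumption_A5 :: "'n::finite set \<Rightarrow> real \<Rightarrow> real ^ 'n ^ 'm::finite \<Rightarrow> bool" where
  "assumption_A5 S lam E \<longleftrightarrow>
     (\<forall>\<xi>::real. \<exists>\<xi>'>0. \<forall>x\<in>feasible S. f2 S lam E x \<le> ereal \<xi> \<longrightarrow>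
        (\<forall>i\<in>- S. 1 / \<xi>' \<le> x $ i \<and> x $ i \<le> \<xi>') \<and> (\<forall>i\<in>S. \<bar>x $ i\<bar> \<le> \<xi>'))"

text \<open>
  \<open>w r i\<close> is the inner iterate \<open>z\<^sup>r\<^sup>,\<^sup>i\<close>. Each one is required to be a minimizer along its coordinate
  line; existence and uniqueness of that minimizer are not part of the definition.
\<close>

definition cyclic_descent ::
  "(nat \<Rightarrow> 'n::finite) \<Rightarrow> (real ^ 'n) set \<Rightarrow> (real ^ 'n \<Rightarrow> ereal) \<Rightarrow> (nat \<Rightarrow> real ^ 'n) \<Rightarrow> bool" where
  "cyclic_descent e X f z \<longleftrightarrow>
     z 0 \<in> X \<and> \<bar>f (z 0)\<bar> \<noteq> \<infinity> \<and>
     (\<exists>w. \<forall>r. w r 0 = z r \<and>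
        (\<forall>i\<in>{1..CARD('n)}.
           is_arg_min f (\<lambda>x. x \<in> X \<and> (\<forall>j. j \<noteq> e i \<longrightarrow> x $ j = w r (i - 1) $ j)) (w r i)) \<and>
        z (Suc r) = w r CARD('n))"

end

theory Submission
  imports Defs
begin

text \<open>
  On its effective domain the objective is \<open>F x = \<parallel>E x\<parallel>\<^sup>2 + (\<Sum>i. \<phi>\<^sub>i (x\<^sub>i))\<close> with convex \<open>\<phi>\<^sub>i\<close>, and
  the exact second-order expansion of the quadratic part (\<open>F_expansion\<close>) gives two estimates for one
  sweep \<open>u \<mapsto> u'\<close> through the coordinates:

  \<^item> \<open>c \<parallel>u' - u\<parallel>\<^sup>2 \<le> F u - F u'\<close>, where \<open>c > 0\<close> is the least squared norm of a column of \<open>E\<close>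
    (\<open>sweep_decrease\<close>);
  \<^item> \<open>F u' - F x \<le> C \<parallel>u' - u\<parallel> \<parallel>x - u'\<parallel>\<close> for all \<open>x\<close> in the domain, because each coordinate of \<open>u'\<close> was
    optimal for a point that differs from \<open>u'\<close> by no more than \<open>u' - u\<close> (\<open>sweep_near_optimal\<close>).

  By the coercivity assumption the iterates stay in a compact box inside the domain. The first
  estimate forces the steps to \<open>0\<close>, the second then shows that every limit point \<open>xs\<close> is a global
  minimizer. This does not yet make the sequence converge: \<open>E\<close> may have a kernel, the minimizer need
  not be unique, and square-summable steps need not be summable.

  The missing ingredient is quadratic growth: every \<open>z\<close> in the box lies within
  \<open>\<kappa> \<surd>(F z - F xs)\<close> of some minimizer (\<open>distance_to_minimizers\<close>). The excess \<open>F z - F xs\<close> is exactly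
  \<open>\<parallel>E (z - xs)\<parallel>\<^sup>2\<close> plus a sum of nonnegative one-variable terms, and the minimizers are the points
  where all of these vanish. Each one-variable term grows at least quadratically away from its zero
  set, an interval; so \<open>z\<close> can be moved first into the product of these intervals and then, within it,
  onto the affine set \<open>E x = E xs\<close>. The second move must not be longer than a multiple of the defect in
  \<open>E\<close>, which is a Hoffman bound (\<open>conformal_hoffman_bound\<close>).

  Let \<open>\<Delta>\<^sub>r = F z\<^sub>r - F xs\<close> and let \<open>\<sigma>\<^sub>r\<close> be the length of the step from \<open>z\<^sub>r\<close>. Quadratic growth in the
  second estimate gives \<open>\<Delta>\<^bsub>r+1\<^esub> \<le> C \<kappa> \<sigma>\<^sub>r \<surd>\<Delta>\<^bsub>r+1\<^esub>\<close>, hence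
  \<open>\<Delta>\<^bsub>r+1\<^esub> \<le> (C \<kappa> \<sigma>\<^sub>r)\<^sup>2 \<le> M (\<Delta>\<^sub>r - \<Delta>\<^bsub>r+1\<^esub>)\<close> by the first. So \<open>\<Delta>\<close> decays geometrically, so do the
  steps, and the sequence converges (\<open>sweeps_converge\<close>).
\<close>

section \<open>A sign-preserving Hoffman bound\<close>

text \<open>
  On the compact set of unit vectors of \<open>K\<close> the continuous function \<open>\<parallel>A v\<parallel>\<close> attains its minimum, which
  is positive; homogeneity extends the bound to the cone.
\<close>
lemma linear_bounded_below_on_closed_cone:
  fixes A :: "'a::euclidean_space \<Rightarrow> 'b::real_normed_vector"
  assumes "linear A" "closed K" "cone K"
    and inj: "\<And>v. v \<in> K \<Longrightarrow> A v = 0 \<Longrightarrow> v = 0"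
  shows "\<exists>\<theta>\<ge>0. \<forall>v\<in>K. norm v \<le> \<theta> * norm (A v)"
proof (cases "K \<inter> sphere 0 1 = {}")
  case True
  have "v = 0" if "v \<in> K" for v
  proof (rule ccontr)
    assume "v \<noteq> 0"
    then have "(1 / norm v) *\<^sub>R v \<in> K \<inter> sphere 0 1"
      using that \<open>cone K\<close> by (auto simp: cone_def)
    with True show False by blast
  qed
  then show ?thesis by (metis norm_zero order_refl mult_zero_left)
next
  case False
  have "continuous_on (K \<inter> sphere 0 1) (\<lambda>v. norm (A v))"
    using \<open>linear A\<close> by (intro continuous_on_norm linear_continuous_on)
      (simp add: linear_conv_bounded_linear)
  moreover have "compact (K \<inter> sphere 0 1)"
    using \<open>closed K\<close> by (simp add: closed_Int_compact)
  ultimately obtain u where u: "u \<in> K" "norm u = 1"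
    and min: "\<And>v. v \<in> K \<inter> sphere 0 1 \<Longrightarrow> norm (A u) \<le> norm (A v)"
    using continuous_attains_inf[of "K \<inter> sphere 0 1" "\<lambda>v. norm (A v)"] False
    by (metis IntE dist_0_norm mem_sphere)
  have pos: "norm (A u) > 0" using inj[of u] u by auto
  have "norm v \<le> (1 / norm (A u)) * norm (A v)" if "v \<in> K" for v
  proof (cases "v = 0")
    case False
    have "(1 / norm v) *\<^sub>R v \<in> K \<inter> sphere 0 1"
      using that False \<open>cone K\<close> by (auto simp: cone_def)
    from min[OF this] have "norm (A u) \<le> norm (A v) / norm v"
      using \<open>linear A\<close> by (simp add: linear_scale)
    then show ?thesis using pos False by (simp add: field_simps)
  qed simp
  then show ?thesis using pos by (metis less_eq_real_def zero_le_divide_1_iff)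
qed

text \<open>
  For disjoint \<open>P\<close> and \<open>N\<close> these are the faces of the closed orthants: \<open>P\<close> holds the coordinates that
  may be positive, \<open>N\<close> those that may be negative.
\<close>
definition sign_cone :: "'n set \<Rightarrow> 'n set \<Rightarrow> (real ^ 'n::finite) set" where
  "sign_cone P N = {d. \<forall>i. (i \<notin> P \<longrightarrow> d $ i \<le> 0) \<and> (i \<notin> N \<longrightarrow> 0 \<le> d $ i)}"

lemma closed_sign_cone: "closed (sign_cone P N)"
proof -
  have "sign_cone P N = (\<Inter>i\<in>- P. {d. d $ i \<le> 0}) \<inter> (\<Inter>i\<in>- N. {d. 0 \<le> d $ i})"
    by (auto simp: sign_cone_def)
  then show ?thesis
    by (auto intro!: closed_Int closed_INT closed_Collect_le continuous_intros)
qed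

lemma cone_sign_cone: "cone (sign_cone P N)"
  by (auto simp: cone_def sign_cone_def mult_nonneg_nonpos)

text \<open>
  Among the preimages of \<open>A d\<close> that lie coordinatewise between \<open>0\<close> and \<open>d\<close>, take one of least
  \<open>\<ell>\<^sub>1\<close> norm. A nonzero kernel vector with compatible signs could be subtracted from it in a small
  multiple, which would keep it between \<open>0\<close> and \<open>d\<close> and shorten it. So the
  kernel of \<open>A\<close> meets the sign cone of this preimage only in \<open>0\<close>.
\<close>
lemma conformal_minimal_preimage:
  fixes A :: "real ^ 'n \<Rightarrow> 'b::real_normed_vector"
  assumes "linear A"
  shows "\<exists>m. A m = A d \<and> (\<forall>i. m $ i \<in> closed_segment 0 (d $ i)) \<and>
    (\<forall>v\<in>sign_cone {i. 0 < m $ i} {i. m $ i < 0}. A v = 0 \<longrightarrow> v = 0)"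
proof -
  let ?D = "{m. A m = A d \<and> (\<forall>i. m $ i \<in> closed_segment 0 (d $ i))}"
  have "?D = A -` {A d} \<inter> (\<Inter>i. (\<lambda>m. m $ i) -` closed_segment 0 (d $ i))" by auto
  moreover have "continuous_on UNIV A"
    using \<open>linear A\<close> by (simp add: linear_continuous_on linear_conv_bounded_linear)
  ultimately have "closed ?D"
    by (auto intro!: closed_Int closed_INT continuous_closed_vimage continuous_intros
        simp: continuous_on_eq_continuous_at)
  moreover have "bounded ?D"
  proof -
    have "norm m \<le> norm d" if "m \<in> ?D" for m
    proof (rule norm_le_componentwise_cart)
      fix i show "norm (m $ i) \<le> norm (d $ i)"
        using that by (auto simp: closed_segment_eq_real_ivl split: if_splits dest!: spec[of _ i])
    qed
    then show ?thesis by (auto simp: bounded_iff)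
  qed
  ultimately have "compact ?D" by (simp add: compact_eq_bounded_closed)
  moreover have "continuous_on ?D (\<lambda>m. \<Sum>i\<in>UNIV. \<bar>m $ i\<bar>)"
    by (intro continuous_intros)
  moreover have "d \<in> ?D" by simp
  ultimately obtain m where m: "m \<in> ?D"
    and min: "\<And>m'. m' \<in> ?D \<Longrightarrow> (\<Sum>i\<in>UNIV. \<bar>m $ i\<bar>) \<le> (\<Sum>i\<in>UNIV. \<bar>m' $ i\<bar>)"
    using continuous_attains_inf[of ?D "\<lambda>m. \<Sum>i\<in>UNIV. \<bar>m $ i\<bar>"] by blast
  have "v = 0" if v: "v \<in> sign_cone {i. 0 < m $ i} {i. m $ i < 0}" and "A v = 0" for v
  proof (rule ccontr)
    assume "v \<noteq> 0"
    have sgn: "(0 < v $ i \<longrightarrow> 0 < m $ i) \<and> (v $ i < 0 \<longrightarrow> m $ i < 0)" for i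
      using v by (auto simp: sign_cone_def not_less[symmetric])
    \<comment> \<open>\<open>b i\<close> is the multiple of \<open>v\<close> whose subtraction from \<open>m\<close> brings coordinate \<open>i\<close> to \<open>0\<close>; a
      coordinate that \<open>v\<close> does not move imposes no limit and gets the dummy value \<open>1\<close>.\<close>
    define b where "b i = (if v $ i = 0 then 1 else \<bar>m $ i\<bar> / \<bar>v $ i\<bar>)" for i
    define t where "t = Min (range b)"
    have "0 < b i" for i
      using sgn[of i] by (cases "v $ i" "0::real" rule: linorder_cases)
        (auto simp: b_def divide_neg_neg)
    moreover have "t \<in> range b" unfolding t_def by (rule Min_in) auto
    ultimately have "t > 0" by auto
    have t: "t * \<bar>v $ i\<bar> \<le> \<bar>m $ i\<bar>" for i
    proof (cases "v $ i = 0")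
      case False
      have "t \<le> b i" unfolding t_def by (rule Min_le) auto
      with False show ?thesis by (simp add: b_def field_simps)
    qed simp
    define m' where "m' = m - t *\<^sub>R v"
    have abs: "\<bar>m' $ i\<bar> = \<bar>m $ i\<bar> - t * \<bar>v $ i\<bar>"
      and seg: "m' $ i \<in> closed_segment 0 (m $ i)" for i
    proof -
      have m': "m' $ i = m $ i - t * v $ i" by (simp add: m'_def)
      consider "v $ i = 0" | "0 < v $ i" "0 < t * v $ i" "0 < m $ i" "t * v $ i \<le> m $ i"
        | "v $ i < 0" "t * v $ i < 0" "m $ i < 0" "m $ i \<le> t * v $ i"
        using sgn[of i] t[of i] \<open>t > 0\<close>
        by (cases "v $ i" "0::real" rule: linorder_cases) (auto simp: mult_pos_neg)
      then have "\<bar>m' $ i\<bar> = \<bar>m $ i\<bar> - t * \<bar>v $ i\<bar> \<and> m' $ i \<in> closed_segment 0 (m $ i)"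
        unfolding m' by cases (auto simp: closed_segment_eq_real_ivl)
      then show "\<bar>m' $ i\<bar> = \<bar>m $ i\<bar> - t * \<bar>v $ i\<bar>" "m' $ i \<in> closed_segment 0 (m $ i)"
        by blast+
    qed
    have "A m' = A d"
      using m \<open>A v = 0\<close> \<open>linear A\<close> by (simp add: m'_def linear_diff linear_scale)
    moreover have "m' $ i \<in> closed_segment 0 (d $ i)" for i
      using seg[of i] m subset_closed_segment[of 0 "m $ i" 0 "d $ i"] by auto
    ultimately have "m' \<in> ?D" by simp
    moreover have "(\<Sum>i\<in>UNIV. \<bar>m' $ i\<bar>) < (\<Sum>i\<in>UNIV. \<bar>m $ i\<bar>)"
    proof -
      obtain k where "v $ k \<noteq> 0" using \<open>v \<noteq> 0\<close> by (auto simp: vec_eq_iff)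
      then show ?thesis
        using \<open>t > 0\<close> by (intro sum_strict_mono_ex1) (auto simp: abs intro!: exI[of _ k])
    qed
    ultimately show False using min by fastforce
  qed
  with m show ?thesis by blast
qed

text \<open>
  There are only finitely many sign cones. On each of those on which \<open>A\<close> has trivial kernel,
  \<open>\<parallel>v\<parallel> \<le> \<theta> \<parallel>A v\<parallel>\<close> for some \<open>\<theta>\<close>, and the minimal preimages above lie in such cones. Hence one constant
  serves all \<open>d\<close>. That \<open>m\<close> stays between \<open>0\<close> and \<open>d\<close> is what keeps \<open>p + m\<close> inside every box containing
  \<open>p\<close> and \<open>p + d\<close>.
\<close>
lemma conformal_hoffman_bound:
  fixes A :: "real ^ 'n \<Rightarrow> 'b::real_normed_vector"
  assumes "linear A"
  shows "\<exists>\<theta>\<ge>0. \<forall>d. \<exists>m. A m = A d \<and> (\<forall>i. m $ i \<in> closed_segment 0 (d $ i)) \<and>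
    norm m \<le> \<theta> * norm (A d)"
proof -
  let ?good = "\<lambda>P N. \<forall>v\<in>sign_cone P N. A v = 0 \<longrightarrow> v = 0"
  have "\<exists>\<theta>\<ge>0. ?good P N \<longrightarrow> (\<forall>v\<in>sign_cone P N. norm v \<le> \<theta> * norm (A v))" for P N
    using linear_bounded_below_on_closed_cone[OF assms closed_sign_cone[of P N] cone_sign_cone]
    by (cases "?good P N") auto
  then obtain \<theta> where \<theta>: "\<And>P N. 0 \<le> \<theta> P N"
    "\<And>P N v. ?good P N \<Longrightarrow> v \<in> sign_cone P N \<Longrightarrow> norm v \<le> \<theta> P N * norm (A v)"
    by metis
  define \<Theta> where "\<Theta> = (\<Sum>(P, N)\<in>UNIV. \<theta> P N)"
  have le: "\<theta> P N \<le> \<Theta>" for P N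
    using member_le_sum[of "(P, N)" UNIV "\<lambda>(P, N). \<theta> P N"] \<theta>(1) by (auto simp: \<Theta>_def)
  have "\<exists>m. A m = A d \<and> (\<forall>i. m $ i \<in> closed_segment 0 (d $ i)) \<and> norm m \<le> \<Theta> * norm (A d)"
    for d
  proof -
    obtain m where m: "A m = A d" "\<forall>i. m $ i \<in> closed_segment 0 (d $ i)"
      "?good {i. 0 < m $ i} {i. m $ i < 0}"
      using conformal_minimal_preimage[OF assms, of d] by blast
    have "m \<in> sign_cone {i. 0 < m $ i} {i. m $ i < 0}" by (auto simp: sign_cone_def)
    from \<theta>(2)[OF m(3) this] have "norm m \<le> \<Theta> * norm (A d)"
      using m(1) le mult_right_mono norm_ge_zero order_trans by metis
    with m show ?thesis by blast
  qed
  moreover have "0 \<le> \<Theta>" using le \<theta>(1) order_trans by blast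
  ultimately show ?thesis by blast
qed

section \<open>Separable perturbations of a quadratic\<close>

locale separable_quadratic =
  fixes E :: "real ^ 'n ^ 'm" and \<phi> :: "'n \<Rightarrow> real \<Rightarrow> real" and D :: "'n \<Rightarrow> real set"
  assumes convex_phi: "convex_on (D i) (\<phi> i)"
begin

definition F :: "real ^ 'n \<Rightarrow> real" where
  "F x = (norm (E *v x))\<^sup>2 + (\<Sum>i\<in>UNIV. \<phi> i (x $ i))"

definition dom :: "(real ^ 'n) set" where
  "dom = {x. \<forall>i. x $ i \<in> D i}"

definition grad :: "real ^ 'n \<Rightarrow> 'n \<Rightarrow> real" where
  "grad w i = 2 * ((E *v w) \<bullet> column i E)"

text \<open>
  The change of \<open>F\<close> when coordinate \<open>i\<close> of \<open>w\<close> is set to \<open>t\<close>, with the quadratic part linearized at \<open>w\<close>.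
  It is nonnegative for all \<open>t\<close> in \<open>D i\<close> exactly when \<open>w\<close> is optimal in coordinate \<open>i\<close>.
\<close>
definition gap :: "real ^ 'n \<Rightarrow> 'n \<Rightarrow> real \<Rightarrow> real" where
  "gap w i t = grad w i * (t - w $ i) + \<phi> i t - \<phi> i (w $ i)"

definition coordinate_step :: "'n \<Rightarrow> real ^ 'n \<Rightarrow> real ^ 'n \<Rightarrow> bool" where
  "coordinate_step i u w \<longleftrightarrow> w \<in> dom \<and> (\<forall>j. j \<noteq> i \<longrightarrow> w $ j = u $ j) \<and>
     (\<forall>x\<in>dom. (\<forall>j. j \<noteq> i \<longrightarrow> x $ j = u $ j) \<longrightarrow> F w \<le> F x)"

lemma matrix_vector_mult_as_sum: "E *v x = (\<Sum>i\<in>UNIV. (x $ i) *\<^sub>R column i E)"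
  by (simp add: matrix_mult_sum scalar_mult_eq_scaleR)

lemma F_expansion:
  "F x = F w + (\<Sum>i\<in>UNIV. gap w i (x $ i)) + (norm (E *v (x - w)))\<^sup>2"
proof -
  have "(E *v w) \<bullet> (E *v (x - w)) = (\<Sum>i\<in>UNIV. (x $ i - w $ i) * ((E *v w) \<bullet> column i E))"
    by (subst (2) matrix_vector_mult_as_sum) (simp add: inner_sum_right)
  then have "(\<Sum>i\<in>UNIV. grad w i * (x $ i - w $ i)) = 2 * ((E *v w) \<bullet> (E *v (x - w)))"
    by (simp add: grad_def sum_distrib_left mult_ac)
  moreover have "(norm (E *v x))\<^sup>2 =
      (norm (E *v w))\<^sup>2 + 2 * ((E *v w) \<bullet> (E *v (x - w))) + (norm (E *v (x - w)))\<^sup>2"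
    by (simp add: matrix_vector_mult_diff_distrib power2_norm_eq_inner inner_diff_left
        inner_diff_right inner_commute algebra_simps)
  ultimately show ?thesis
    by (simp add: F_def gap_def sum.distrib sum_subtractf)
qed

lemma gap_self [simp]: "gap w i (w $ i) = 0"
  by (simp add: gap_def)

lemma convex_on_gap: "convex_on (D i) (gap w i)"
proof (rule convex_onI)
  fix t x y :: real assume t: "0 < t" "t < 1" and xy: "x \<in> D i" "y \<in> D i"
  have "\<phi> i ((1 - t) *\<^sub>R x + t *\<^sub>R y) \<le> (1 - t) * \<phi> i x + t * \<phi> i y"
    using convex_onD[OF convex_phi, of t x i y] t xy by simp
  then show "gap w i ((1 - t) *\<^sub>R x + t *\<^sub>R y) \<le> (1 - t) * gap w i x + t * gap w i y"
    by (simp add: gap_def algebra_simps)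
qed (use convex_phi convex_on_imp_convex in blast)

lemma gap_change_one:
  assumes "\<And>j. j \<noteq> i \<Longrightarrow> x $ j = w $ j"
  shows "F x = F w + gap w i (x $ i) + (norm (column i E))\<^sup>2 * (x $ i - w $ i)\<^sup>2"
proof -
  have "(\<Sum>j\<in>UNIV. gap w j (x $ j)) = (\<Sum>j\<in>UNIV. if j = i then gap w i (x $ i) else 0)"
    by (intro sum.cong) (auto simp: assms)
  moreover have "x - w = (x $ i - w $ i) *\<^sub>R axis i 1"
    by (auto simp: vec_eq_iff axis_def assms)
  then have "norm (E *v (x - w)) = \<bar>x $ i - w $ i\<bar> * norm (column i E)"
    by (metis matrix_vector_mult_scaleR matrix_vector_mult_basis norm_scaleR)
  ultimately show ?thesis
    by (subst F_expansion[of _ w]) (simp add: power_mult_distrib)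
qed

text \<open>
  Move coordinate \<open>i\<close> only by the fraction \<open>s\<close> of the way to \<open>t\<close>. Optimality and convexity give
  \<open>0 \<le> s (gap w i t) + s\<^sup>2 K\<close>; for small \<open>s\<close> the second-order term cannot compensate a negative gap.
\<close>
lemma coordinate_step_gap_nonneg:
  assumes "coordinate_step i u w" "t \<in> D i"
  shows "0 \<le> gap w i t"
proof (rule ccontr)
  assume neg: "\<not> 0 \<le> gap w i t"
  define K where "K = (norm (column i E))\<^sup>2 * (t - w $ i)\<^sup>2"
  have K: "K \<ge> 0" by (simp add: K_def)
  have wi: "w $ i \<in> D i" using assms by (auto simp: coordinate_step_def dom_def)
  have ge: "0 \<le> s * gap w i t + s\<^sup>2 * K" if s: "0 < s" "s < 1" for s :: real
  proof -
    let ?p = "(1 - s) * w $ i + s * t"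
    define x where "x = (\<chi> j. if j = i then ?p else w $ j)"
    have p: "?p \<in> D i"
      using convexD_alt[of "D i" "w $ i" t s] convex_on_imp_convex[OF convex_phi] wi assms s
      by auto
    have "x \<in> dom" "\<forall>j. j \<noteq> i \<longrightarrow> x $ j = u $ j"
      using assms(1) p unfolding coordinate_step_def dom_def x_def
      by (simp_all, metis)
    then have "F w \<le> F x"
      using assms(1) by (simp add: coordinate_step_def)
    moreover have "F x = F w + gap w i ?p + (norm (column i E))\<^sup>2 * (?p - w $ i)\<^sup>2"
      using gap_change_one[of i x w] by (simp add: x_def)
    moreover have "gap w i ?p \<le> s * gap w i t"
      using convex_onD[OF convex_on_gap[of i w], of s "w $ i" t] wi assms s by simp
    moreover have "?p - w $ i = s * (t - w $ i)" by (simp add: algebra_simps)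
    then have "(norm (column i E))\<^sup>2 * (?p - w $ i)\<^sup>2 = s\<^sup>2 * K"
      by (simp add: K_def power_mult_distrib)
    ultimately show ?thesis by linarith
  qed
  \<comment> \<open>Small enough that \<open>s K\<close> is at most half of \<open>- gap w i t\<close>; with \<open>K + 1\<close> instead of \<open>K\<close> the
    quotient makes sense also for \<open>K = 0\<close>.\<close>
  define s where "s = min (1/2) (- gap w i t / (2 * (K + 1)))"
  have s: "0 < s" "s < 1" using neg K by (auto simp: s_def intro!: divide_neg_pos)
  have "s * K \<le> s * (K + 1)" using s by simp
  also have "\<dots> \<le> - gap w i t / (2 * (K + 1)) * (K + 1)"
    using K by (intro mult_right_mono) (auto simp: s_def)
  also have "\<dots> = - gap w i t / 2" using K by (simp add: field_simps)
  also have "\<dots> < - gap w i t" using neg by simp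
  finally have "s * (gap w i t + s * K) < 0" using s by (simp add: mult_pos_neg)
  with ge[OF s] show False by (simp add: power2_eq_square algebra_simps)
qed

lemma coordinate_step_decrease:
  assumes "coordinate_step i u w" "u \<in> dom"
  shows "(norm (column i E))\<^sup>2 * (u $ i - w $ i)\<^sup>2 \<le> F u - F w"
proof -
  have "F u = F w + gap w i (u $ i) + (norm (column i E))\<^sup>2 * (u $ i - w $ i)\<^sup>2"
    using assms by (intro gap_change_one) (auto simp: coordinate_step_def)
  moreover have "0 \<le> gap w i (u $ i)"
    using assms by (intro coordinate_step_gap_nonneg) (auto simp: dom_def)
  ultimately show ?thesis by simp
qed

lemma minimizer_gap_nonneg:
  assumes "w \<in> dom" "\<And>x. x \<in> dom \<Longrightarrow> F w \<le> F x" "t \<in> D i"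
  shows "0 \<le> gap w i t"
proof (rule coordinate_step_gap_nonneg)
  show "coordinate_step i w w" unfolding coordinate_step_def using assms(1,2) by blast
qed fact

section \<open>One sweep over the coordinates\<close>

definition sweep :: "(nat \<Rightarrow> 'n) \<Rightarrow> real ^ 'n \<Rightarrow> real ^ 'n \<Rightarrow> bool" where
  "sweep e u u' \<longleftrightarrow> (\<exists>w. w 0 = u \<and> w CARD('n) = u' \<and>
     (\<forall>k<CARD('n). coordinate_step (e (Suc k)) (w k) (w (Suc k))))"

text \<open>
  A sweep visits each coordinate exactly once. So, just before and just after coordinate \<open>e (Suc k)\<close> is
  updated, it has its initial and its final value, and every intermediate point agrees in each
  coordinate with one of the two endpoints.
\<close>
lemma sweep_coordinates:
  assumes "bij_betw e {1..CARD('n)} (UNIV :: 'n set)"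
    and step: "\<And>k. k < CARD('n) \<Longrightarrow> coordinate_step (e (Suc k)) (w k) (w (Suc k))"
    and "k < CARD('n)"
  shows "w k $ e (Suc k) = w 0 $ e (Suc k)"
    and "w (Suc k) $ e (Suc k) = w CARD('n) $ e (Suc k)"
    and "\<bar>w CARD('n) $ j - w (Suc k) $ j\<bar> \<le> \<bar>w CARD('n) $ j - w 0 $ j\<bar>"
proof -
  have inj: "e a = e b \<longleftrightarrow> a = b" if "a \<in> {1..CARD('n)}" "b \<in> {1..CARD('n)}" for a b
    using bij_betw_imp_inj_on[OF assms(1)] that by (rule inj_on_eq_iff)
  have unchanged: "w (Suc a) $ j = w a $ j" if "a < CARD('n)" "j \<noteq> e (Suc a)" for a j
    using step[OF that(1)] that by (auto simp: coordinate_step_def)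
  have before: "a \<le> l \<Longrightarrow> w a $ e (Suc l) = w 0 $ e (Suc l)" if "l < CARD('n)" for l a
  proof (induction a)
    case (Suc a)
    have "e (Suc l) \<noteq> e (Suc a)" using inj[of "Suc l" "Suc a"] Suc that by auto
    with Suc that unchanged[of a "e (Suc l)"] show ?case by simp
  qed simp
  have after: "b \<le> CARD('n) \<Longrightarrow> w b $ e (Suc l) = w (Suc l) $ e (Suc l)"
    if "l < CARD('n)" "Suc l \<le> b" for l b
    using that(2)
  proof (induction b rule: dec_induct)
    case (step b)
    have "e (Suc l) \<noteq> e (Suc b)" using inj[of "Suc l" "Suc b"] step that by auto
    with step unchanged[of b "e (Suc l)"] show ?case by simp
  qed simp
  show "w k $ e (Suc k) = w 0 $ e (Suc k)" using before assms(3) by blast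
  show "w (Suc k) $ e (Suc k) = w CARD('n) $ e (Suc k)" using after[of k "CARD('n)"] assms(3) by simp
  obtain l' where "l' \<in> {1..CARD('n)}" "j = e l'"
    using assms(1) by (metis UNIV_I bij_betw_def imageE)
  then obtain l where l: "l < CARD('n)" "j = e (Suc l)"
    by (cases l') (auto simp: Suc_le_eq)
  show "\<bar>w CARD('n) $ j - w (Suc k) $ j\<bar> \<le> \<bar>w CARD('n) $ j - w 0 $ j\<bar>"
  proof (cases "l \<le> k")
    case True
    then show ?thesis
      using after[OF l(1), of "Suc k"] after[OF l(1), of "CARD('n)"] l assms(3) by simp
  next
    case False
    then show ?thesis using before[OF l(1), of "Suc k"] l by simp
  qed
qed

text \<open>
  The decreases of the single coordinate steps telescope, and the squared coordinate moves sum to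
  \<open>\<parallel>u' - u\<parallel>\<^sup>2\<close>.
\<close>
lemma sweep_decrease:
  assumes e: "bij_betw e {1..CARD('n)} (UNIV :: 'n set)"
    and c: "\<And>i. c \<le> (norm (column i E))\<^sup>2"
    and "sweep e u u'" "u \<in> dom"
  shows "c * (norm (u' - u))\<^sup>2 \<le> F u - F u'"
proof -
  obtain w where w: "w 0 = u" "w CARD('n) = u'"
    and step: "\<And>k. k < CARD('n) \<Longrightarrow> coordinate_step (e (Suc k)) (w k) (w (Suc k))"
    using assms(3) by (auto simp: sweep_def)
  have dom: "w k \<in> dom" if "k < CARD('n)" for k
    using that step[of "k - 1"] w \<open>u \<in> dom\<close> by (cases k) (auto simp: coordinate_step_def)
  have one: "c * (u' $ e (Suc k) - u $ e (Suc k))\<^sup>2 \<le> F (w k) - F (w (Suc k))"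
    if k: "k < CARD('n)" for k
  proof -
    have "c * (w k $ e (Suc k) - w (Suc k) $ e (Suc k))\<^sup>2
        \<le> (norm (column (e (Suc k)) E))\<^sup>2 * (w k $ e (Suc k) - w (Suc k) $ e (Suc k))\<^sup>2"
      by (intro mult_right_mono c) simp
    also have "\<dots> \<le> F (w k) - F (w (Suc k))"
      by (intro coordinate_step_decrease step dom k)
    finally show ?thesis
      using sweep_coordinates(1,2)[OF e step k] w by (simp add: power2_commute)
  qed
  have "(norm (u' - u))\<^sup>2 = (\<Sum>i\<in>UNIV. (u' $ i - u $ i)\<^sup>2)"
    by (simp add: norm_vec_def L2_set_def sum_nonneg)
  also have "\<dots> = (\<Sum>k\<in>{1..CARD('n)}. (u' $ e k - u $ e k)\<^sup>2)"
    using sum.reindex_bij_betw[OF e, of "\<lambda>i. (u' $ i - u $ i)\<^sup>2"] by simp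
  also have "\<dots> = (\<Sum>k<CARD('n). (u' $ e (Suc k) - u $ e (Suc k))\<^sup>2)"
    by (simp add: sum.atLeast1_atMost_eq)
  finally have "c * (norm (u' - u))\<^sup>2 = (\<Sum>k<CARD('n). c * (u' $ e (Suc k) - u $ e (Suc k))\<^sup>2)"
    by (simp add: sum_distrib_left)
  also have "\<dots> \<le> (\<Sum>k<CARD('n). F (w k) - F (w (Suc k)))"
    by (intro sum_mono one) simp
  also have "\<dots> = F u - F u'" by (simp add: sum_lessThan_telescope'[of "\<lambda>k. F (w k)"] w)
  finally show ?thesis .
qed

text \<open>
  Coordinate \<open>i\<close> of \<open>u'\<close> was optimal at the point \<open>v\<close> reached when it was updated, and \<open>v\<close> and \<open>u'\<close> share
  this coordinate. So the gaps of \<open>u'\<close> and of \<open>v\<close> differ only through the gradient of the quadratic part,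
  which is Lipschitz, and \<open>\<parallel>u' - v\<parallel> \<le> \<parallel>u' - u\<parallel>\<close>.
\<close>
lemma sweep_near_optimal:
  assumes e: "bij_betw e {1..CARD('n)} (UNIV :: 'n set)"
  shows "\<exists>C\<ge>0. \<forall>u u' x. sweep e u u' \<longrightarrow> x \<in> dom \<longrightarrow>
    F u' - F x \<le> C * norm (u' - u) * norm (x - u')"
proof -
  obtain L where L: "L > 0" "\<And>v. norm (E *v v) \<le> norm v * L"
    using bounded_linear.pos_bounded[OF matrix_vector_mul_bounded_linear[of E]] by blast
  define C where "C = (\<Sum>i\<in>UNIV. 2 * (L * norm (column i E)))"
  have "F u' - F x \<le> C * norm (u' - u) * norm (x - u')" if "sweep e u u'" "x \<in> dom" for u u' x
  proof -
    obtain w where w: "w 0 = u" "w CARD('n) = u'"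
      and step: "\<And>k. k < CARD('n) \<Longrightarrow> coordinate_step (e (Suc k)) (w k) (w (Suc k))"
      using \<open>sweep e u u'\<close> by (auto simp: sweep_def)
    have one: "- gap u' i (x $ i) \<le> 2 * (L * norm (column i E)) * (norm (u' - u) * norm (x - u'))" for i
    proof -
      obtain k' where "k' \<in> {1..CARD('n)}" "i = e k'"
        using e by (metis UNIV_I bij_betw_def imageE)
      then obtain k where k: "k < CARD('n)" and i: "i = e (Suc k)" by (cases k') (auto simp: Suc_le_eq)
      note co = sweep_coordinates[OF e step k, unfolded w, folded i]
      let ?v = "w (Suc k)"
      have "norm (u' - ?v) \<le> norm (u' - u)"
        by (intro norm_le_componentwise_cart) (use co(3) in simp)
      then have "norm (u' - ?v) * L \<le> norm (u' - u) * L"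
        using L(1) by (intro mult_right_mono) auto
      then have "norm (E *v (u' - ?v)) \<le> L * norm (u' - u)"
        using L(2)[of "u' - ?v"] by (simp add: mult.commute)
      then have "\<bar>(E *v (u' - ?v)) \<bullet> column i E\<bar> \<le> L * norm (u' - u) * norm (column i E)"
        using Cauchy_Schwarz_ineq2[of "E *v (u' - ?v)" "column i E"]
        by (meson mult_right_mono norm_ge_zero order_trans)
      then have g: "\<bar>grad u' i - grad ?v i\<bar> \<le> 2 * (L * norm (u' - u) * norm (column i E))"
        by (simp add: grad_def matrix_vector_mult_diff_distrib inner_diff_left)
      \<comment> \<open>The \<open>\<phi>\<close> terms of the two gaps coincide, since \<open>?v\<close> and \<open>u'\<close> agree in coordinate \<open>i\<close>.\<close>
      have "0 \<le> gap ?v i (x $ i)"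
        using coordinate_step_gap_nonneg[OF step[OF k]] \<open>x \<in> dom\<close> by (simp add: i dom_def)
      then have "- gap u' i (x $ i) \<le> - ((grad u' i - grad ?v i) * (x $ i - u' $ i))"
        by (simp add: gap_def co(2) algebra_simps)
      also have "\<dots> \<le> \<bar>grad u' i - grad ?v i\<bar> * \<bar>(x - u') $ i\<bar>"
        by (simp flip: abs_mult)
      also have "\<dots> \<le> 2 * (L * norm (u' - u) * norm (column i E)) * norm (x - u')"
        by (intro mult_mono g component_le_norm_cart) (use L in auto)
      finally show ?thesis by (simp add: mult_ac)
    qed
    have "F u' - F x \<le> (\<Sum>i\<in>UNIV. - gap u' i (x $ i))"
      by (subst (2) F_expansion[of _ u']) (simp add: sum_negf)
    also have "\<dots> \<le> (\<Sum>i\<in>UNIV. 2 * (L * norm (column i E)) * (norm (u' - u) * norm (x - u')))"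
      by (intro sum_mono one)
    also have "\<dots> = C * norm (u' - u) * norm (x - u')"
      by (simp add: C_def sum_distrib_right mult.assoc)
    finally show ?thesis .
  qed
  moreover have "C \<ge> 0" using L by (auto simp: C_def intro!: sum_nonneg)
  ultimately show ?thesis by blast
qed

end

section \<open>Quadratic growth and linear convergence\<close>

text \<open>
  The assumption \<open>coordinate_growth\<close> says: once \<open>a\<close> minimizes the function \<open>\<phi> i\<close> tilted by the slope
  \<open>\<gamma>\<close>, the excess of this function over its minimum dominates a multiple of the squared distance to
  its minimizers. It is required on a bounded interval only, because both \<open>- ln t\<close> and \<open>\<bar>t\<bar>\<close> grow at
  most linearly at infinity after tilting.
\<close>
locale quadratic_growth = separable_quadratic E \<phi> D
  for E :: "real ^ 'n ^ 'm" and \<phi> D +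
  fixes lo hi :: "'n \<Rightarrow> real"
  assumes continuous_phi: "continuous_on (D i) (\<phi> i)"
    and column_nonzero: "column i E \<noteq> 0"
    and box_subset: "{lo i..hi i} \<subseteq> D i"
    and coordinate_growth:
      "a \<in> D i \<Longrightarrow> (\<And>t. t \<in> D i \<Longrightarrow> 0 \<le> \<gamma> * (t - a) + \<phi> i t - \<phi> i a) \<Longrightarrow>
       \<exists>\<eta>>0. \<forall>t\<in>{lo i..hi i}. \<exists>p\<in>D i. \<gamma> * (p - a) + \<phi> i p - \<phi> i a = 0 \<and>
         \<eta> * (t - p)\<^sup>2 \<le> \<gamma> * (t - a) + \<phi> i t - \<phi> i a"
begin

definition box :: "(real ^ 'n) set" where
  "box = {x. \<forall>i. x $ i \<in> {lo i..hi i}}"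

lemma box_in_dom: "box \<subseteq> dom"
  using box_subset unfolding box_def dom_def by blast

lemma compact_box: "compact box"
proof -
  have "box = cbox (\<chi> i. lo i) (\<chi> i. hi i)"
    by (auto simp: box_def mem_box_cart)
  then show ?thesis by simp
qed

lemma continuous_on_F: "continuous_on dom F"
  unfolding F_def
  by (intro continuous_intros continuous_on_compose2[OF continuous_phi] matrix_vector_mult_linear_continuous_on)
    (auto simp: dom_def)

text \<open>
  Write \<open>\<Delta> = F z - F xs\<close>, which is \<open>\<parallel>E (z - xs)\<parallel>\<^sup>2\<close> plus the gaps of \<open>xs\<close> at the coordinates of \<open>z\<close>. By
  coordinatewise growth there is a point \<open>p\<close> at which all these gaps vanish and \<open>\<parallel>z - p\<parallel> = O(\<surd>\<Delta>)\<close>; so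
  \<open>\<parallel>E (xs - p)\<parallel> = O(\<surd>\<Delta>)\<close> too. The Hoffman bound moves \<open>p\<close> by \<open>O(\<surd>\<Delta>)\<close> to a point \<open>x\<close> with \<open>E x = E xs\<close>
  that lies coordinatewise between \<open>p\<close> and \<open>xs\<close>. A gap is convex and nonnegative and vanishes at both
  ends, hence also at \<open>x\<close>, and the expansion gives \<open>F x = F xs\<close>.
\<close>
lemma distance_to_minimizers:
  assumes xs: "xs \<in> dom" and min: "\<And>x. x \<in> dom \<Longrightarrow> F xs \<le> F x"
  shows "\<exists>\<kappa>\<ge>0. \<forall>z\<in>box. \<exists>x\<in>dom. F x = F xs \<and> norm (x - z) \<le> \<kappa> * sqrt (F z - F xs)"
proof -
  have nonneg: "0 \<le> gap xs i t" if "t \<in> D i" for i t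
    using minimizer_gap_nonneg[of xs t i] xs min that by blast
  have "\<exists>\<eta>>0. \<forall>t\<in>{lo i..hi i}. \<exists>p\<in>D i. gap xs i p = 0 \<and> \<eta> * (t - p)\<^sup>2 \<le> gap xs i t" for i
    unfolding gap_def
    by (rule coordinate_growth) (use xs nonneg in \<open>auto simp: dom_def gap_def\<close>)
  then obtain \<eta>' where \<eta>': "\<And>i. \<eta>' i > 0"
    "\<And>i t. t \<in> {lo i..hi i} \<Longrightarrow> \<exists>p\<in>D i. gap xs i p = 0 \<and> \<eta>' i * (t - p)\<^sup>2 \<le> gap xs i t"
    by metis
  define \<eta> where "\<eta> = Min (range \<eta>')"
  have \<eta>: "\<eta> > 0" "\<And>i. \<eta> \<le> \<eta>' i" using \<eta>'(1) by (auto simp: \<eta>_def)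
  obtain L where L: "L > 0" "\<And>v. norm (E *v v) \<le> norm v * L"
    using bounded_linear.pos_bounded[OF matrix_vector_mul_bounded_linear[of E]] by blast
  obtain \<theta> where \<theta>: "\<theta> \<ge> 0" "\<And>d. \<exists>m. E *v m = E *v d \<and>
      (\<forall>i. m $ i \<in> closed_segment 0 (d $ i)) \<and> norm m \<le> \<theta> * norm (E *v d)"
    using conformal_hoffman_bound[OF matrix_vector_mul_linear[of E]] by blast
  define \<kappa> where "\<kappa> = 1 / sqrt \<eta> + \<theta> * (1 + L / sqrt \<eta>)"
  have "\<exists>x\<in>dom. F x = F xs \<and> norm (x - z) \<le> \<kappa> * sqrt (F z - F xs)" if "z \<in> box" for z
  proof -
    define \<Delta> where "\<Delta> = F z - F xs"
    have zdom: "z $ i \<in> D i" for i using that box_in_dom by (auto simp: dom_def)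
    have \<Delta>: "\<Delta> = (\<Sum>i\<in>UNIV. gap xs i (z $ i)) + (norm (E *v (z - xs)))\<^sup>2"
      using F_expansion[of z xs] by (simp add: \<Delta>_def)
    have sum_nn: "(\<Sum>i\<in>UNIV. gap xs i (z $ i)) \<ge> 0" by (intro sum_nonneg nonneg zdom)
    have "\<exists>p. p \<in> D i \<and> gap xs i p = 0 \<and> \<eta>' i * (z $ i - p)\<^sup>2 \<le> gap xs i (z $ i)" for i
      using \<eta>'(2)[of "z $ i" i] that unfolding box_def by blast
    then obtain p' where p': "\<And>i. p' i \<in> D i" "\<And>i. gap xs i (p' i) = 0"
      "\<And>i. \<eta>' i * (z $ i - p' i)\<^sup>2 \<le> gap xs i (z $ i)"
      by metis
    define p where "p = (\<chi> i. p' i)"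
    have "\<eta> * (norm (z - p))\<^sup>2 = (\<Sum>i\<in>UNIV. \<eta> * (z $ i - p' i)\<^sup>2)"
      by (simp add: p_def norm_vec_def L2_set_def sum_nonneg sum_distrib_left)
    also have "\<dots> \<le> (\<Sum>i\<in>UNIV. gap xs i (z $ i))"
      by (intro sum_mono order_trans[OF mult_right_mono[OF \<eta>(2)] p'(3)]) simp
    also have "\<dots> \<le> \<Delta>" by (simp add: \<Delta>)
    finally have "(norm (z - p))\<^sup>2 \<le> \<Delta> / \<eta>" using \<eta> by (simp add: field_simps)
    then have zp: "norm (z - p) \<le> sqrt \<Delta> / sqrt \<eta>"
      using real_le_rsqrt real_sqrt_divide by metis
    have Ez: "norm (E *v (z - xs)) \<le> sqrt \<Delta>"
      using sum_nn by (intro real_le_rsqrt) (simp add: \<Delta>)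
    have "E *v (xs - p) = E *v (z - p) - E *v (z - xs)"
      by (simp add: matrix_vector_mult_diff_distrib)
    then have "norm (E *v (xs - p)) \<le> norm (E *v (z - p)) + norm (E *v (z - xs))"
      by (simp add: norm_triangle_ineq4)
    also have "norm (E *v (z - p)) \<le> sqrt \<Delta> / sqrt \<eta> * L"
      using L(2)[of "z - p"] mult_right_mono[OF zp, of L] L(1) by linarith
    finally have Exp: "norm (E *v (xs - p)) \<le> sqrt \<Delta> * (1 + L / sqrt \<eta>)"
      using Ez by (simp add: algebra_simps)
    obtain m where m: "E *v m = E *v (xs - p)" "\<And>i. m $ i \<in> closed_segment 0 (xs $ i - p $ i)"
      "norm m \<le> \<theta> * norm (E *v (xs - p))"
      using \<theta>(2)[of "xs - p"] by auto
    define x where "x = p + m"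
    have x_between: "x $ i \<in> closed_segment (p' i) (xs $ i)" for i
      using m(2)[of i] by (auto simp: x_def p_def closed_segment_eq_real_ivl split: if_splits)
    have x_gap: "x $ i \<in> D i" "gap xs i (x $ i) = 0" for i
    proof -
      have xsi: "xs $ i \<in> D i" using xs by (simp add: dom_def)
      then show x: "x $ i \<in> D i"
        using x_between[of i] p'(1)[of i] convex_on_imp_convex[OF convex_phi[of i]]
        by (meson closed_segment_subset subsetD)
      obtain s where s: "x $ i = (1 - s) *\<^sub>R p' i + s *\<^sub>R xs $ i" "0 \<le> s" "s \<le> 1"
        using x_between[of i] by (auto simp: in_segment)
      have "gap xs i (x $ i) \<le> (1 - s) * gap xs i (p' i) + s * gap xs i (xs $ i)"
        unfolding s(1) using convex_onD[OF convex_on_gap s(2,3) p'(1) xsi] .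
      then show "gap xs i (x $ i) = 0" using nonneg[OF x] p'(2) by simp
    qed
    have "E *v (x - xs) = 0"
      using m(1) by (simp add: x_def matrix_vector_mult_diff_distrib matrix_vector_right_distrib)
    then have "F x = F xs" using x_gap(2) F_expansion[of x xs] by simp
    moreover have "norm (x - z) \<le> \<kappa> * sqrt \<Delta>"
    proof -
      have "norm (x - z) \<le> norm m + norm (z - p)"
        using norm_triangle_ineq4[of m "z - p"] by (simp add: x_def algebra_simps)
      also have "norm m \<le> \<theta> * (sqrt \<Delta> * (1 + L / sqrt \<eta>))"
        using m(3) mult_left_mono[OF Exp \<theta>(1)] by linarith
      finally show ?thesis using zp by (simp add: \<kappa>_def algebra_simps)
    qed
    ultimately show ?thesis using x_gap(1) by (auto simp: \<Delta>_def dom_def)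
  qed
  moreover have "\<kappa> \<ge> 0" using \<eta>(1) \<theta>(1) L(1) by (simp add: \<kappa>_def)
  ultimately show ?thesis by blast
qed

lemma column_norms_bounded_below: "\<exists>c>0. \<forall>i. c \<le> (norm (column i E))\<^sup>2"
  using column_nonzero
  by (intro exI[of _ "Min (range (\<lambda>i. (norm (column i E))\<^sup>2))"]) auto

text \<open>
  The values \<open>F (z r)\<close> decrease and, by continuity along a convergent subsequence, tend to \<open>F xs\<close>. So the
  decreases tend to \<open>0\<close>, and with them the steps. As \<open>x - z r\<close> is bounded, the bound of
  \<open>sweep_near_optimal\<close> becomes \<open>F xs \<le> F x\<close> in the limit.
\<close>
lemma sweep_limit_point_minimizes:
  assumes e: "bij_betw e {1..CARD('n)} (UNIV :: 'n set)"
    and sweep: "\<And>r. sweep e (z r) (z (Suc r))"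
    and box: "\<And>r. z r \<in> box"
  shows "\<exists>xs s. strict_mono s \<and> (z \<circ> s) \<longlonglongrightarrow> xs \<and> xs \<in> dom \<and> (\<forall>x\<in>dom. F xs \<le> F x)"
proof -
  have dom: "z r \<in> dom" for r using box box_in_dom by blast
  obtain c where c: "c > 0" "\<And>i. c \<le> (norm (column i E))\<^sup>2"
    using column_norms_bounded_below by blast
  obtain C where C: "C \<ge> 0" "\<And>u u' x. sweep e u u' \<Longrightarrow> x \<in> dom \<Longrightarrow>
      F u' - F x \<le> C * norm (u' - u) * norm (x - u')"
    using sweep_near_optimal[OF e] by blast
  note dec = sweep_decrease[OF e c(2) sweep dom]
  obtain xs s where s: "xs \<in> box" "strict_mono s" "(z \<circ> s) \<longlonglongrightarrow> xs"
    using compact_box box unfolding compact_def by metis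
  have xs: "xs \<in> dom" using s box_in_dom by blast
  have Fs: "(\<lambda>k. F (z (s k))) \<longlonglongrightarrow> F xs"
    using continuous_on_tendsto_compose[OF continuous_on_F s(3) xs] dom by (simp add: o_def)
  have decseq: "decseq (\<lambda>r. F (z r))"
  proof (rule decseq_SucI)
    fix r show "F (z (Suc r)) \<le> F (z r)"
      using dec[of r] c(1) by (smt (verit) mult_nonneg_nonneg zero_le_power2)
  qed
  have Fz: "(\<lambda>r. F (z r)) \<longlonglongrightarrow> F xs"
  proof -
    have ge: "F xs \<le> F (z r)" for r
    proof (rule LIMSEQ_le_const2[OF Fs], intro exI allI impI)
      fix k assume "r \<le> k"
      then have "r \<le> s k" using seq_suble[OF s(2)] order_trans by blast
      with decseq show "F (z (s k)) \<le> F (z r)" by (auto simp: decseq_def)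
    qed
    then obtain l where l: "(\<lambda>r. F (z r)) \<longlonglongrightarrow> l"
      using decseq_convergent[OF decseq] by metis
    have "l = F xs" using LIMSEQ_subseq_LIMSEQ[OF l s(2)] Fs LIMSEQ_unique by (auto simp: o_def)
    with l show ?thesis by simp
  qed
  have steps: "(\<lambda>r. norm (z (Suc r) - z r)) \<longlonglongrightarrow> 0"
  proof -
    have "(\<lambda>r. sqrt ((F (z r) - F (z (Suc r))) / c)) \<longlonglongrightarrow> sqrt ((F xs - F xs) / c)"
      using c(1) by (intro tendsto_intros Fz LIMSEQ_Suc[OF Fz]) auto
    then have "(\<lambda>r. sqrt ((F (z r) - F (z (Suc r))) / c)) \<longlonglongrightarrow> 0" by simp
    moreover have "norm (z (Suc r) - z r) \<le> sqrt ((F (z r) - F (z (Suc r))) / c)" for r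
      using dec[of r] c(1) by (intro real_le_rsqrt) (simp add: field_simps)
    ultimately show ?thesis
      by (intro Lim_null_comparison[where f = "\<lambda>r. norm (z (Suc r) - z r)"]) auto
  qed
  obtain B where B: "\<And>x. x \<in> box \<Longrightarrow> norm x \<le> B"
    using compact_imp_bounded[OF compact_box] by (auto simp: bounded_iff)
  have "F xs \<le> F x" if x: "x \<in> dom" for x
  proof -
    have "F (z (Suc r)) \<le> F x + C * norm (z (Suc r) - z r) * (norm x + B)" for r
    proof -
      have "norm (x - z (Suc r)) \<le> norm x + B"
        using norm_triangle_ineq4[of x "z (Suc r)"] B[OF box, of "Suc r"] by linarith
      then have "C * norm (z (Suc r) - z r) * norm (x - z (Suc r))
          \<le> C * norm (z (Suc r) - z r) * (norm x + B)"
        using C(1) by (intro mult_left_mono) auto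
      with C(2)[OF sweep x, of r] show ?thesis by linarith
    qed
    moreover have "(\<lambda>r. F x + C * norm (z (Suc r) - z r) * (norm x + B)) \<longlonglongrightarrow> F x + C * 0 * (norm x + B)"
      by (intro tendsto_intros steps)
    ultimately show ?thesis
      using LIMSEQ_le[OF LIMSEQ_Suc[OF Fz]] by auto
  qed
  with s xs show ?thesis by blast
qed

text \<open>
  Sufficient decrease, near-optimality and quadratic growth combine to a contraction
  \<open>\<Delta> (Suc r) \<le> q * \<Delta> r\<close> with \<open>q < 1\<close>. The steps are bounded by \<open>\<surd>(\<Delta> r / c)\<close>, hence summable, and the
  limit is the limit point found above.
\<close>
theorem sweeps_converge:
  assumes e: "bij_betw e {1..CARD('n)} (UNIV :: 'n set)"
    and sweep: "\<And>r. sweep e (z r) (z (Suc r))"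
    and box: "\<And>r. z r \<in> box"
  shows "\<exists>zs\<in>dom. z \<longlonglongrightarrow> zs \<and> (\<forall>x\<in>dom. F zs \<le> F x)"
proof -
  have dom: "z r \<in> dom" for r using box box_in_dom by blast
  obtain c where c: "c > 0" "\<And>i. c \<le> (norm (column i E))\<^sup>2"
    using column_norms_bounded_below by blast
  obtain C where C: "C \<ge> 0" "\<And>u u' x. sweep e u u' \<Longrightarrow> x \<in> dom \<Longrightarrow>
      F u' - F x \<le> C * norm (u' - u) * norm (x - u')"
    using sweep_near_optimal[OF e] by blast
  obtain xs s where s: "strict_mono s" "(z \<circ> s) \<longlonglongrightarrow> xs"
    and xs: "xs \<in> dom" and min: "\<And>x. x \<in> dom \<Longrightarrow> F xs \<le> F x"
    using sweep_limit_point_minimizes[of e z] assms by metis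
  obtain \<kappa> where \<kappa>: "\<kappa> \<ge> 0" "\<And>z. z \<in> box \<Longrightarrow>
      \<exists>x\<in>dom. F x = F xs \<and> norm (x - z) \<le> \<kappa> * sqrt (F z - F xs)"
    using distance_to_minimizers[OF xs min] by blast
  define \<Delta> where "\<Delta> r = F (z r) - F xs" for r
  define \<sigma> where "\<sigma> r = norm (z (Suc r) - z r)" for r
  have \<Delta>0: "\<Delta> r \<ge> 0" for r using min[OF dom] by (simp add: \<Delta>_def)
  have dec: "c * (\<sigma> r)\<^sup>2 \<le> \<Delta> r - \<Delta> (Suc r)" for r
    using sweep_decrease[OF e c(2) sweep dom, of r] by (simp add: \<sigma>_def \<Delta>_def)
  define M where "M = (C * \<kappa>)\<^sup>2 / c"
  have "M \<ge> 0" using c by (simp add: M_def)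
  have rec: "\<Delta> (Suc r) \<le> M * (\<Delta> r - \<Delta> (Suc r))" for r
  proof -
    let ?q = "sqrt (\<Delta> (Suc r))"
    obtain x where x: "x \<in> dom" "F x = F xs" "norm (x - z (Suc r)) \<le> \<kappa> * ?q"
      using \<kappa>(2)[OF box, of "Suc r"] by (auto simp: \<Delta>_def)
    have "?q * ?q = F (z (Suc r)) - F x" using \<Delta>0[of "Suc r"] x by (simp add: \<Delta>_def)
    also have "\<dots> \<le> C * \<sigma> r * norm (x - z (Suc r))"
      using C(2)[OF sweep x(1), of r] by (simp add: \<sigma>_def)
    also have "\<dots> \<le> C * \<sigma> r * (\<kappa> * ?q)"
      using C(1) x(3) by (intro mult_left_mono) (auto simp: \<sigma>_def)
    finally have "?q * ?q \<le> (C * \<kappa> * \<sigma> r) * ?q" by (simp add: mult_ac)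
    then have "?q \<le> C * \<kappa> * \<sigma> r"
    proof (cases "?q = 0")
      case True
      then show ?thesis using C(1) \<kappa>(1) by (simp add: \<sigma>_def)
    next
      case False
      then have "0 < ?q" using \<Delta>0[of "Suc r"] by simp
      with \<open>?q * ?q \<le> _\<close> show ?thesis by (rule mult_right_le_imp_le)
    qed
    then have "?q\<^sup>2 \<le> (C * \<kappa> * \<sigma> r)\<^sup>2"
      using \<Delta>0[of "Suc r"] by (intro power_mono) auto
    also have "\<dots> = M * (c * (\<sigma> r)\<^sup>2)" using c(1) by (simp add: M_def power_mult_distrib)
    also have "\<dots> \<le> M * (\<Delta> r - \<Delta> (Suc r))" by (intro mult_left_mono dec \<open>M \<ge> 0\<close>)
    finally show ?thesis using \<Delta>0[of "Suc r"] by simp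
  qed
  define q where "q = M / (1 + M)"
  have q: "0 \<le> q" "q < 1" using \<open>M \<ge> 0\<close> by (auto simp: q_def)
  have geo: "\<Delta> r \<le> q ^ r * \<Delta> 0" for r
  proof (induction r)
    case (Suc r)
    have "\<Delta> (Suc r) \<le> q * \<Delta> r"
      using rec[of r] \<open>M \<ge> 0\<close> by (simp add: q_def field_simps)
    also have "\<dots> \<le> q * (q ^ r * \<Delta> 0)" by (intro mult_left_mono Suc q)
    finally show ?case by (simp add: mult_ac)
  qed simp
  have "\<sigma> r \<le> sqrt (\<Delta> 0 / c) * sqrt q ^ r" for r
  proof -
    have "(\<sigma> r)\<^sup>2 \<le> (q ^ r * \<Delta> 0) / c"
      using dec[of r] geo[of r] \<Delta>0[of "Suc r"] c(1) by (simp add: field_simps)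
    then have "\<sigma> r \<le> sqrt ((q ^ r * \<Delta> 0) / c)" by (rule real_le_rsqrt)
    then show ?thesis by (simp add: real_sqrt_mult real_sqrt_divide real_sqrt_power mult_ac)
  qed
  moreover have "summable (\<lambda>r. sqrt (\<Delta> 0 / c) * sqrt q ^ r)"
    using q by (intro summable_mult summable_geometric) simp
  ultimately have "summable (\<lambda>r. z (Suc r) - z r)"
    unfolding \<sigma>_def by (intro summable_comparison_test[OF _ \<open>summable _\<close>]) blast
  then have "(\<lambda>r. (\<Sum>k<r. z (Suc k) - z k) + z 0) \<longlonglongrightarrow> (\<Sum>k. z (Suc k) - z k) + z 0"
    by (intro tendsto_intros summable_LIMSEQ)
  then obtain l where l: "z \<longlonglongrightarrow> l" by (simp add: sum_lessThan_telescope)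
  have "l = xs" using LIMSEQ_subseq_LIMSEQ[OF l s(1)] s(2) LIMSEQ_unique by blast
  with l xs min show ?thesis by blast
qed

end

section \<open>The two coordinate penalties\<close>

text \<open>
  Testing nonnegativity at \<open>0\<close> and \<open>2 a\<close> gives \<open>\<gamma> a + lam \<bar>a\<bar> = 0\<close>, so the tilted function is
  \<open>\<gamma> t + lam \<bar>t\<bar>\<close>: linear with slopes \<open>lam + \<gamma>\<close> and \<open>- (lam - \<gamma>)\<close> on the two half-lines. On a half-line
  where the slope is zero every point is a minimizer; on one where it is not, \<open>0\<close> is the nearest
  minimizer and linear growth dominates quadratic growth on \<open>\<bar>t\<bar> \<le> B\<close>.
\<close>
lemma abs_penalty_growth:
  fixes \<gamma> lam a B :: real
  assumes nonneg: "\<And>t. 0 \<le> \<gamma> * (t - a) + lam * \<bar>t\<bar> - lam * \<bar>a\<bar>"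
  shows "\<exists>\<eta>>0. \<forall>t. \<bar>t\<bar> \<le> B \<longrightarrow> (\<exists>p. \<gamma> * (p - a) + lam * \<bar>p\<bar> - lam * \<bar>a\<bar> = 0 \<and>
    \<eta> * (t - p)\<^sup>2 \<le> \<gamma> * (t - a) + lam * \<bar>t\<bar> - lam * \<bar>a\<bar>)"
proof -
  have "\<gamma> * a + lam * \<bar>a\<bar> = 0"
    using nonneg[of 0] nonneg[of "2 * a"] by (simp add: algebra_simps)
  then have eq: "\<gamma> * (t - a) + lam * \<bar>t\<bar> - lam * \<bar>a\<bar> = \<gamma> * t + lam * \<bar>t\<bar>" for t
    by (simp add: algebra_simps)
  have slopes: "0 \<le> lam + \<gamma>" "0 \<le> lam - \<gamma>"
    using nonneg[of 1] nonneg[of "-1"] unfolding eq by auto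
  define \<eta> where "\<eta> = min (if lam + \<gamma> = 0 then 1 else (lam + \<gamma>) / (\<bar>B\<bar> + 1))
    (if lam - \<gamma> = 0 then 1 else (lam - \<gamma>) / (\<bar>B\<bar> + 1))"
  have "\<eta> > 0" using slopes by (auto simp: \<eta>_def)
  have small: "\<eta> * t\<^sup>2 \<le> b * \<bar>t\<bar>"
    if "\<bar>t\<bar> \<le> B" "b > 0" "\<eta> \<le> b / (\<bar>B\<bar> + 1)" for t b
  proof -
    have "\<eta> * \<bar>t\<bar> \<le> \<eta> * (\<bar>B\<bar> + 1)" using that(1) \<open>\<eta> > 0\<close> by (intro mult_left_mono) auto
    also have "\<dots> \<le> b" using that(3) by (simp add: field_simps)
    finally have "\<eta> * \<bar>t\<bar> * \<bar>t\<bar> \<le> b * \<bar>t\<bar>" by (intro mult_right_mono) auto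
    then show ?thesis by (simp add: power2_eq_square)
  qed
  have "\<exists>p. \<gamma> * p + lam * \<bar>p\<bar> = 0 \<and> \<eta> * (t - p)\<^sup>2 \<le> \<gamma> * t + lam * \<bar>t\<bar>" if t: "\<bar>t\<bar> \<le> B" for t
  proof (cases "\<gamma> * t + lam * \<bar>t\<bar> = 0")
    case True
    then show ?thesis by (intro exI[of _ t]) simp
  next
    case False
    have "\<eta> * t\<^sup>2 \<le> \<gamma> * t + lam * \<bar>t\<bar>"
    proof (cases "t \<ge> 0")
      case True
      have "lam + \<gamma> \<noteq> 0"
      proof
        assume "lam + \<gamma> = 0"
        then have "\<gamma> = - lam" by simp
        with False True show False by simp
      qed
      with small[OF t, of "lam + \<gamma>"] slopes have "\<eta> * t\<^sup>2 \<le> (lam + \<gamma>) * \<bar>t\<bar>" by (auto simp: \<eta>_def)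
      with True show ?thesis by (simp add: algebra_simps)
    next
      case neg: False
      have "lam - \<gamma> \<noteq> 0" using False neg by auto
      with small[OF t, of "lam - \<gamma>"] slopes have "\<eta> * t\<^sup>2 \<le> (lam - \<gamma>) * \<bar>t\<bar>" by (auto simp: \<eta>_def)
      with neg show ?thesis by (simp add: algebra_simps)
    qed
    then show ?thesis by (intro exI[of _ 0]) simp
  qed
  with \<open>\<eta> > 0\<close> show ?thesis unfolding eq by blast
qed

text \<open>
  Stationarity at \<open>a\<close> gives \<open>\<gamma> = 1 / a\<close>. With \<open>y = \<surd>(t / a)\<close> the tilted function is \<open>y\<^sup>2 - 1 - 2 ln y\<close>, which
  is at least \<open>(y - 1)\<^sup>2\<close> because \<open>ln y \<le> y - 1\<close>; and \<open>t - a = a (y + 1) (y - 1)\<close>, where \<open>y\<close> is bounded for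
  \<open>t \<le> B\<close>.
\<close>
lemma log_penalty_growth:
  fixes \<gamma> a B :: real
  assumes a: "a > 0" and nonneg: "\<And>t. t > 0 \<Longrightarrow> 0 \<le> \<gamma> * (t - a) + - ln t - - ln a"
  shows "\<exists>\<eta>>0. \<forall>t. 0 < t \<and> t \<le> B \<longrightarrow> \<eta> * (t - a)\<^sup>2 \<le> \<gamma> * (t - a) + - ln t - - ln a"
proof -
  have "((\<lambda>t. \<gamma> * (t - a) + - ln t - - ln a) has_real_derivative \<gamma> - 1 / a) (at a)"
    using a by (auto intro!: derivative_eq_intros)
  from DERIV_local_min[OF this a] have "\<gamma> - 1 / a = 0"
    using nonneg by (simp add: abs_less_iff)
  then have \<gamma>: "\<gamma> = 1 / a" by simp
  define \<eta> where "\<eta> = 1 / (a * (sqrt (\<bar>B\<bar> / a) + 1))\<^sup>2"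
  have "sqrt (\<bar>B\<bar> / a) + 1 > 0" using a by (simp add: add_nonneg_pos)
  then have "\<eta> > 0" using a by (simp add: \<eta>_def)
  moreover have "\<eta> * (t - a)\<^sup>2 \<le> \<gamma> * (t - a) + - ln t - - ln a" if t: "0 < t" "t \<le> B" for t
  proof -
    define y where "y = sqrt (t / a)"
    have y: "y > 0" "t = a * y\<^sup>2" using a t by (auto simp: y_def)
    have "ln y \<le> y - 1" using ln_le_minus_one y by blast
    then have "(y - 1)\<^sup>2 \<le> y\<^sup>2 - 1 - 2 * ln y" by (simp add: power2_eq_square algebra_simps)
    also have "\<dots> = \<gamma> * (t - a) + - ln t - - ln a"
      using a y(1) unfolding y(2) \<gamma> by (simp add: ln_mult ln_realpow field_simps)
    finally have ge: "(y - 1)\<^sup>2 \<le> \<gamma> * (t - a) + - ln t - - ln a" .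
    have "y \<le> sqrt (\<bar>B\<bar> / a)" unfolding y_def using t a by (simp add: divide_right_mono)
    then have "(a * (y + 1))\<^sup>2 \<le> (a * (sqrt (\<bar>B\<bar> / a) + 1))\<^sup>2"
      using a y by (intro power_mono mult_left_mono) auto
    then have "\<eta> * (a * (y + 1))\<^sup>2 \<le> 1"
      using \<open>\<eta> > 0\<close> by (simp add: \<eta>_def divide_le_eq_1)
    then have "\<eta> * (a * (y + 1))\<^sup>2 * (y - 1)\<^sup>2 \<le> 1 * (y - 1)\<^sup>2" by (intro mult_right_mono) auto
    moreover have "t - a = a * (y + 1) * (y - 1)" by (simp add: y power2_eq_square algebra_simps)
    ultimately show ?thesis using ge by (simp add: power_mult_distrib mult_ac)
  qed
  ultimately show ?thesis by blast
qed

definition penalty :: "'n set \<Rightarrow> real \<Rightarrow> 'n \<Rightarrow> real \<Rightarrow> real" where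
  "penalty S lam i t = (if i \<in> S then lam * \<bar>t\<bar> else - ln t)"

definition penalty_dom :: "'n set \<Rightarrow> 'n \<Rightarrow> real set" where
  "penalty_dom S i = (if i \<in> S then UNIV else {0<..})"

lemma separable_quadratic_penalty:
  assumes "lam > 0"
  shows "separable_quadratic (penalty S lam) (penalty_dom S)"
proof
  fix i
  show "convex_on (penalty_dom S i) (penalty S lam i)"
  proof (cases "i \<in> S")
    case True
    have "convex_on UNIV (\<lambda>t::real. lam * \<bar>t\<bar>)"
      using assms convex_on_cmul[OF _ convex_on_dist[of UNIV "0::real"], of lam] by simp
    then show ?thesis using True by (simp add: penalty_def[abs_def] penalty_dom_def)
  next
    case False
    have "convex_on {0<..} (\<lambda>t::real. - ln t)"
      using minus_log_convex[of "exp 1"] by (simp add: log_def)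
    then show ?thesis using False by (simp add: penalty_def[abs_def] penalty_dom_def)
  qed
qed

lemma quadratic_growth_penalty:
  assumes "lam > 0" "\<forall>j. column j E \<noteq> 0" "\<And>i. i \<notin> S \<Longrightarrow> 0 < lo i"
  shows "quadratic_growth E (penalty S lam) (penalty_dom S) lo hi"
proof -
  interpret separable_quadratic E "penalty S lam" "penalty_dom S"
    by (rule separable_quadratic_penalty[OF assms(1)])
  show ?thesis
  proof
    fix i
    show "continuous_on (penalty_dom S i) (penalty S lam i)"
      unfolding penalty_dom_def penalty_def[abs_def]
      by (cases "i \<in> S") (auto intro!: continuous_intros)
    show "column i E \<noteq> 0" using assms by blast
    show "{lo i..hi i} \<subseteq> penalty_dom S i"
      using assms(3)[of i] by (auto simp: penalty_dom_def)
  next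
    fix a i \<gamma>
    assume a: "a \<in> penalty_dom S i"
      and nn: "\<And>t. t \<in> penalty_dom S i \<Longrightarrow> 0 \<le> \<gamma> * (t - a) + penalty S lam i t - penalty S lam i a"
    show "\<exists>\<eta>>0. \<forall>t\<in>{lo i..hi i}. \<exists>p\<in>penalty_dom S i.
        \<gamma> * (p - a) + penalty S lam i p - penalty S lam i a = 0 \<and>
        \<eta> * (t - p)\<^sup>2 \<le> \<gamma> * (t - a) + penalty S lam i t - penalty S lam i a"
    proof (cases "i \<in> S")
      case True
      have "\<And>t. 0 \<le> \<gamma> * (t - a) + lam * \<bar>t\<bar> - lam * \<bar>a\<bar>"
        using nn True by (simp add: penalty_def penalty_dom_def)
      from abs_penalty_growth[OF this, of "max \<bar>lo i\<bar> \<bar>hi i\<bar>"] obtain \<eta> where \<eta>: "\<eta> > 0"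
        "\<And>t. \<bar>t\<bar> \<le> max \<bar>lo i\<bar> \<bar>hi i\<bar> \<Longrightarrow> \<exists>p. \<gamma> * (p - a) + lam * \<bar>p\<bar> - lam * \<bar>a\<bar> = 0 \<and>
          \<eta> * (t - p)\<^sup>2 \<le> \<gamma> * (t - a) + lam * \<bar>t\<bar> - lam * \<bar>a\<bar>" by blast
      show ?thesis
      proof (intro exI[of _ \<eta>] conjI ballI \<eta>(1))
        fix t assume "t \<in> {lo i..hi i}"
        then have "\<bar>t\<bar> \<le> max \<bar>lo i\<bar> \<bar>hi i\<bar>" by auto
        from \<eta>(2)[OF this] show "\<exists>p\<in>penalty_dom S i.
            \<gamma> * (p - a) + penalty S lam i p - penalty S lam i a = 0 \<and>
            \<eta> * (t - p)\<^sup>2 \<le> \<gamma> * (t - a) + penalty S lam i t - penalty S lam i a"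
          using True by (simp add: penalty_def penalty_dom_def)
      qed
    next
      case False
      have pos: "a > 0" using a False by (simp add: penalty_dom_def)
      have "\<And>t. t > 0 \<Longrightarrow> 0 \<le> \<gamma> * (t - a) + - ln t - - ln a"
        using nn False by (simp add: penalty_def penalty_dom_def)
      from log_penalty_growth[OF pos this, of "hi i"] obtain \<eta> where \<eta>: "\<eta> > 0"
        "\<And>t. 0 < t \<Longrightarrow> t \<le> hi i \<Longrightarrow> \<eta> * (t - a)\<^sup>2 \<le> \<gamma> * (t - a) + - ln t - - ln a" by blast
      show ?thesis
      proof (intro exI[of _ \<eta>] conjI ballI bexI[of _ a] \<eta>(1) a)
        fix t assume "t \<in> {lo i..hi i}"
        then have "0 < t" "t \<le> hi i" using assms(3)[OF False] by auto
        from \<eta>(2)[OF this]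
        show "\<eta> * (t - a)\<^sup>2 \<le> \<gamma> * (t - a) + penalty S lam i t - penalty S lam i a"
          using False by (simp add: penalty_def)
      qed simp
    qed
  qed
qed

section \<open>Descent for the extended-valued objective\<close>

lemma f2_eq_objective:
  fixes E :: "real ^ 'n ^ 'm"
  assumes "lam > 0" "x \<in> separable_quadratic.dom (penalty_dom S)"
  shows "f2 S lam E x = ereal (separable_quadratic.F E (penalty S lam) x)"
proof -
  interpret separable_quadratic E "penalty S lam" "penalty_dom S"
    by (rule separable_quadratic_penalty[OF assms(1)])
  have pos: "0 < x $ i" if "i \<in> - S" for i
  proof -
    have "x $ i \<in> penalty_dom S i" using assms(2) by (simp add: dom_def)
    with that show ?thesis by (simp add: penalty_dom_def)
  qed
  have "x \<bullet> ((transpose E ** E) *v x) = (norm (E *v x))\<^sup>2"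
    by (metis dot_lmul_matrix inner_commute matrix_vector_mul_assoc power2_norm_eq_inner
        transpose_matrix_vector)
  moreover have "(\<Sum>i\<in>- S. neg_log (x $ i)) = ereal (\<Sum>i\<in>- S. - ln (x $ i))"
    unfolding sum_ereal[symmetric] by (intro sum.cong) (auto simp: neg_log_def pos)
  moreover have "(\<Sum>i\<in>UNIV. penalty S lam i (x $ i)) =
      (\<Sum>i\<in>- S. - ln (x $ i)) + lam * (\<Sum>i\<in>S. \<bar>x $ i\<bar>)"
  proof -
    have "(\<Sum>i\<in>UNIV. penalty S lam i (x $ i)) =
        (\<Sum>i\<in>- S. penalty S lam i (x $ i)) + (\<Sum>i\<in>S. penalty S lam i (x $ i))"
      by (subst sum.union_disjoint[symmetric]) (auto simp: Compl_partition2)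
    then show ?thesis by (simp add: penalty_def sum_distrib_left)
  qed
  ultimately show ?thesis by (simp add: f2_def F_def)
qed

lemma f2_finite_iff:
  fixes E :: "real ^ 'n ^ 'm"
  assumes "lam > 0"
  shows "f2 S lam E x < \<infinity> \<longleftrightarrow> x \<in> separable_quadratic.dom (penalty_dom S)"
proof -
  interpret separable_quadratic E "penalty S lam" "penalty_dom S"
    by (rule separable_quadratic_penalty[OF assms(1)])
  show ?thesis
  proof (cases "x \<in> dom")
    case True
    then show ?thesis using f2_eq_objective[OF assms True, of E] by simp
  next
    case False
    then obtain i where "i \<in> - S" "neg_log (x $ i) = \<infinity>"
      by (auto simp: dom_def penalty_dom_def neg_log_def split: if_splits)
    then have "(\<Sum>i\<in>- S. neg_log (x $ i)) = \<infinity>" by (auto simp: sum_Pinfty)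
    with False show ?thesis by (simp add: f2_def)
  qed
qed

lemma dom_subset_feasible: "separable_quadratic.dom (penalty_dom S) \<subseteq> feasible S"
proof -
  interpret separable_quadratic undefined "penalty S 1" "penalty_dom S"
    by (rule separable_quadratic_penalty) simp
  show ?thesis
  proof
    fix x assume "x \<in> dom"
    then have in_dom: "x $ i \<in> penalty_dom S i" for i by (simp add: dom_def)
    have "0 < x $ i" if "i \<notin> S" for i
      using in_dom[of i] that by (simp add: penalty_dom_def)
    then show "x \<in> feasible S" by (auto simp: feasible_def less_imp_le)
  qed
qed

theorem theorem2p2:
  fixes E :: "real ^ 'n ^ 'm"
    and S :: "'n set"
    and lam :: real
    and e :: "nat \<Rightarrow> 'n"
    and z :: "nat \<Rightarrow> real ^ 'n"
  assumes "bij_betw e {1..CARD('n)} (UNIV :: 'n set)"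
    and "lam > 0"
    and "\<forall>j. column j E \<noteq> 0"
    and "assumption_A5 S lam E"
    and "cyclic_descent e (feasible S) (f2 S lam E) z"
  shows "\<exists>zs\<in>feasible S. z \<longlonglongrightarrow> zs \<and> (\<forall>x\<in>feasible S. f2 S lam E zs \<le> f2 S lam E x)"
proof -
  interpret sq: separable_quadratic E "penalty S lam" "penalty_dom S"
    by (rule separable_quadratic_penalty[OF assms(2)])
  note f2_F = f2_eq_objective[OF assms(2), where S = S and E = E]
  note finite_iff = f2_finite_iff[OF assms(2), where S = S and E = E]
  note feas = dom_subset_feasible[of S]
  obtain w where w0: "\<And>r. w r 0 = z r" and wn: "\<And>r. z (Suc r) = w r CARD('n)"
    and arg: "\<And>r i. i \<in> {1..CARD('n)} \<Longrightarrow> is_arg_min (f2 S lam E)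
      (\<lambda>x. x \<in> feasible S \<and> (\<forall>j. j \<noteq> e i \<longrightarrow> x $ j = w r (i - 1) $ j)) (w r i)"
    using assms(5) unfolding cyclic_descent_def by blast
  \<comment> \<open>Minimizing over a coordinate line in the feasible set is the same as minimizing over its part
    in the domain of \<open>F\<close>: starting from a finite value, no minimizer can have an infinite one.\<close>
  have step: "sq.coordinate_step (e (Suc k)) (w r k) (w r (Suc k)) \<and>
      f2 S lam E (w r (Suc k)) \<le> f2 S lam E (w r k)"
    if k: "k < CARD('n)" and dom: "w r k \<in> sq.dom" for r k
  proof -
    have least: "f2 S lam E (w r (Suc k)) \<le> f2 S lam E x"
      if "x \<in> sq.dom" "\<forall>j. j \<noteq> e (Suc k) \<longrightarrow> x $ j = w r k $ j" for x
      using arg[of "Suc k" r] k that feas by (auto simp: is_arg_min_def not_less)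
    have fin: "w r (Suc k) \<in> sq.dom"
      using least[OF dom] finite_iff dom by (metis order_le_less_trans)
    moreover have "\<forall>j. j \<noteq> e (Suc k) \<longrightarrow> w r (Suc k) $ j = w r k $ j"
      using arg[of "Suc k" r] k by (auto simp: is_arg_min_def)
    moreover have "sq.F (w r (Suc k)) \<le> sq.F x"
      if "x \<in> sq.dom" "\<forall>j. j \<noteq> e (Suc k) \<longrightarrow> x $ j = w r k $ j" for x
      using least[OF that] f2_F[OF fin] f2_F[OF that(1)] by simp
    ultimately show ?thesis
      using least[OF dom] by (auto simp: sq.coordinate_step_def)
  qed
  have inner: "w r k \<in> sq.dom \<and> f2 S lam E (w r k) \<le> f2 S lam E (z r)"
    if "z r \<in> sq.dom" "k \<le> CARD('n)" for r k
    using that(2)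
  proof (induction k)
    case 0
    then show ?case using that w0 by simp
  next
    case (Suc k)
    then show ?case using step[of k r] by (auto simp: sq.coordinate_step_def intro: order_trans)
  qed
  have outer: "z r \<in> sq.dom \<and> f2 S lam E (z r) \<le> f2 S lam E (z 0)" for r
  proof (induction r)
    case 0
    have "f2 S lam E (z 0) < \<infinity>" using assms(5) by (auto simp: cyclic_descent_def)
    then show ?case using finite_iff by blast
  next
    case (Suc r)
    then show ?case using inner[of r "CARD('n)"] wn by (auto intro: order_trans)
  qed
  have sweep: "sq.sweep e (z r) (z (Suc r))" for r
    unfolding sq.sweep_def using w0 wn step inner outer by (intro exI[of _ "w r"]) auto
  obtain \<xi> where \<xi>: "\<xi> > 0" "\<And>x. x \<in> feasible S \<Longrightarrow> f2 S lam E x \<le> f2 S lam E (z 0) \<Longrightarrow>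
      (\<forall>i\<in>- S. 1 / \<xi> \<le> x $ i \<and> x $ i \<le> \<xi>) \<and> (\<forall>i\<in>S. \<bar>x $ i\<bar> \<le> \<xi>)"
    using assms(4) f2_F[of "z 0"] outer[of 0] unfolding assumption_A5_def by metis
  \<comment> \<open>Coercivity at level \<open>f2 (z 0)\<close> confines all outer iterates to a box whose log coordinates stay
    away from \<open>0\<close>.\<close>
  define lo where "lo i = (if i \<in> S then - \<xi> else 1 / \<xi>)" for i
  interpret qg: quadratic_growth E "penalty S lam" "penalty_dom S" lo "\<lambda>_. \<xi>"
    by (rule quadratic_growth_penalty) (use assms \<xi>(1) in \<open>auto simp: lo_def\<close>)
  have "z r \<in> qg.box" for r
    using \<xi>(2)[of "z r"] outer[of r] feas by (fastforce simp: qg.box_def lo_def abs_le_iff)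
  with qg.sweeps_converge[of e z] assms(1) sweep obtain zs
    where zs: "zs \<in> sq.dom" "z \<longlonglongrightarrow> zs" "\<And>x. x \<in> sq.dom \<Longrightarrow> sq.F zs \<le> sq.F x" by blast
  have "f2 S lam E zs \<le> f2 S lam E x" for x
  proof (cases "x \<in> sq.dom")
    case True
    then show ?thesis using zs f2_F by simp
  next
    case False
    then have "f2 S lam E x = \<infinity>" using finite_iff by auto
    then show ?thesis by simp
  qed
  with zs feas show ?thesis by blast
qed

end
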